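(* $\mathrm{HGP}(B_{2,3})=\mathrm{HGP}(B_{2,4})=7$, and $\mathrm{HGP}(B_{2,n})\le n+3$ for every $n\ge 4$. Moreover, $\mathrm{HGP}(B_{2,n})\ge 8$ for every $n\ge 6$.
   Context: Proper hat-guessing game: let $G=(V,E)$ be a finite simple graph and $[q]=\{0,1,\dots,q-1\}$. Before play, the vertices agree on deterministic guess functions; the guess of each vertex is a function of the colors on its open neighborhood, with values in $[q]$. An adversary assigns a color from $[q]$ to every vertex so that adjacent vertices get distinct colors (a proper $q$-coloring). All vertices simultaneously guess their own colors. A strategy (family of guess functions) is winning with $q$ colors if for every proper $q$-coloring at least one vertex guesses its own color correctly. The proper hat-guessing number $\mathrm{HGP}(G)$ is the largest $q$ for which a winning strategy exists. The book graph is $B_{k,n}=K_k\vee\overline{K_n}$ (join): $k$ mutually adjacent vertices (spines) and $n$ pairwise nonadjacent vertices (pages), every page adjacent to every spine. *)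

theory Defs
  imports "Graph_Theory.Pair_Digraph" "HOL-Library.FuncSet"
begin

text \<open>
  Finite simple graphs are the graphs G with \<^term>\<open>pair_graph G\<close>: as usual in \<^theory>\<open>Graph_Theory.Digraph\<close>,
  an undirected edge is the pair of its two opposite arcs.
\<close>

definition open_nbhd :: "'a pair_pre_digraph \<Rightarrow> 'a \<Rightarrow> 'a set" where
  "open_nbhd G v = {u. (v, u) \<in> parcs G}"

definition proper_colorings :: "'a pair_pre_digraph \<Rightarrow> nat \<Rightarrow> ('a \<Rightarrow> nat) set" where
  "proper_colorings G q =
     {c \<in> pverts G \<rightarrow>\<^sub>E {..<q}. \<forall>(u, v) \<in> parcs G. c u \<noteq> c v}"

text \<open>
  The guess function of v takes the restriction of the coloring to the open neighborhood of v.
  Only its values on such restrictions are constrained and used.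
\<close>

definition strategies :: "'a pair_pre_digraph \<Rightarrow> nat \<Rightarrow> ('a \<Rightarrow> ('a \<Rightarrow> nat) \<Rightarrow> nat) set" where
  "strategies G q = (\<Pi> v \<in> pverts G. (open_nbhd G v \<rightarrow>\<^sub>E {..<q}) \<rightarrow> {..<q})"

definition winning_strategy ::
  "'a pair_pre_digraph \<Rightarrow> nat \<Rightarrow> ('a \<Rightarrow> ('a \<Rightarrow> nat) \<Rightarrow> nat) \<Rightarrow> bool" where
  "winning_strategy G q g \<longleftrightarrow>
     g \<in> strategies G q \<and>
     (\<forall>c \<in> proper_colorings G q. \<exists>v \<in> pverts G. g v (restrict c (open_nbhd G v)) = c v)"

definition winnable :: "'a pair_pre_digraph \<Rightarrow> nat \<Rightarrow> bool" where
  "winnable G q \<longleftrightarrow> (\<exists>g. winning_strategy G q g)"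

text \<open>The maximum exists for every nonempty finite simple graph, see \<open>HGP_greatest\<close> below.\<close>

definition HGP :: "'a pair_pre_digraph \<Rightarrow> nat" where
  "HGP G = (GREATEST q. winnable G q)"

definition complete_graph :: "nat \<Rightarrow> nat pair_pre_digraph" where
  "complete_graph k = \<lparr>pverts = {..<k}, parcs = {(i, j). i < k \<and> j < k \<and> i \<noteq> j}\<rparr>"

definition edgeless_graph :: "nat \<Rightarrow> nat pair_pre_digraph" where
  "edgeless_graph n = \<lparr>pverts = {..<n}, parcs = {}\<rparr>"

definition graph_join ::
  "'a pair_pre_digraph \<Rightarrow> 'b pair_pre_digraph \<Rightarrow> ('a + 'b) pair_pre_digraph" where
  "graph_join G H =
     \<lparr>pverts = pverts G <+> pverts H,
      parcs = {(Inl u, Inl v) | u v. (u, v) \<in> parcs G} \<union>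
              {(Inr u, Inr v) | u v. (u, v) \<in> parcs H} \<union>
              {(Inl u, Inr v) | u v. u \<in> pverts G \<and> v \<in> pverts H} \<union>
              {(Inr v, Inl u) | u v. u \<in> pverts G \<and> v \<in> pverts H}\<rparr>"

definition book_graph :: "nat \<Rightarrow> nat \<Rightarrow> (nat + nat) pair_pre_digraph" where
  "book_graph k n = graph_join (complete_graph k) (edgeless_graph n)"

lemma pair_graph_book_graph: "pair_graph (book_graph k n)"
proof -
  let ?G = "book_graph k n"
  have sub: "parcs ?G \<subseteq> pverts ?G \<times> pverts ?G"
    by (auto simp: book_graph_def graph_join_def complete_graph_def edgeless_graph_def)
  have fin: "finite (pverts ?G)"
    by (auto simp: book_graph_def graph_join_def complete_graph_def edgeless_graph_def)
  have fin': "finite (parcs ?G)"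
    using sub fin by (meson finite_SigmaI finite_subset)
  have sym: "sym (parcs ?G)"
    by (auto simp: sym_def book_graph_def graph_join_def complete_graph_def edgeless_graph_def)
  have loop: "fst e \<noteq> snd e" if "e \<in> parcs ?G" for e
    using that by (auto simp: book_graph_def graph_join_def complete_graph_def edgeless_graph_def)
  show ?thesis
    using sub fin fin' sym loop by unfold_locales (auto simp: symmetric_def)
qed

lemma winnable_1:
  assumes "pair_graph G" "pverts G \<noteq> {}"
  shows "winnable G 1"
proof -
  have "winning_strategy G 1 (\<lambda>_ _. 0)"
    using assms(2) by (fastforce simp: winning_strategy_def strategies_def proper_colorings_def PiE_def Pi_def)
  then show ?thesis by (auto simp: winnable_def)
qed

lemma card_determined_colorings:
  fixes f :: "('a \<Rightarrow> nat) \<Rightarrow> nat"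
  assumes "finite V" "v \<in> V"
    and f: "\<And>c d. \<forall>u \<in> V - {v}. c u = d u \<Longrightarrow> f c = f d"
  shows "card {c \<in> V \<rightarrow>\<^sub>E {..<q}. c v = f c} \<le> q ^ (card V - 1)"
proof -
  let ?S = "{c \<in> V \<rightarrow>\<^sub>E {..<q}. c v = f c}"
  let ?r = "\<lambda>c. restrict c (V - {v})"
  have "inj_on ?r ?S"
  proof (rule inj_onI)
    fix c d assume c: "c \<in> ?S" and d: "d \<in> ?S" and eq: "?r c = ?r d"
    have off: "\<forall>u \<in> V - {v}. c u = d u"
      using eq by (metis restrict_apply')
    have "c v = d v" using c d f[OF off] by simp
    then have "c u = d u" if "u \<in> V" for u using off that by (cases "u = v") auto
    then show "c = d" using c d by (intro PiE_ext[of c V "\<lambda>_. {..<q}" d]) auto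
  qed
  moreover have "?r ` ?S \<subseteq> (V - {v}) \<rightarrow>\<^sub>E {..<q}"
    by (auto simp: PiE_iff restrict_def extensional_def split: if_splits)
  moreover have "finite ((V - {v}) \<rightarrow>\<^sub>E {..<q})" using assms(1) by (intro finite_PiE) auto
  ultimately have "card ?S \<le> card ((V - {v}) \<rightarrow>\<^sub>E {..<q})" by (rule card_inj_on_le)
  also have "\<dots> = q ^ (card V - 1)" using assms(1,2) by (simp add: card_PiE)
  finally show ?thesis .
qed

lemma winnable_le:
  assumes G: "pair_graph G" and ne: "pverts G \<noteq> {}" and win: "winnable G q"
  shows "q \<le> card (pverts G) + card (parcs G)"
proof (cases "q = 0")
  case False
  interpret pair_graph G by (rule G)
  let ?V = "pverts G" and ?E = "parcs G"
  let ?C = "?V \<rightarrow>\<^sub>E {..<q}"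
  have fin: "finite ?V" "finite ?E" using pair_finite_verts pair_finite_arcs by auto
  obtain g where g: "\<forall>c \<in> proper_colorings G q. \<exists>v \<in> ?V. g v (restrict c (open_nbhd G v)) = c v"
    using win by (auto simp: winnable_def winning_strategy_def)
  define A where "A v = {c \<in> ?C. c v = g v (restrict c (open_nbhd G v))}" for v
  define B where "B e = {c \<in> ?C. c (fst e) = c (snd e)}" for e
  have N: "open_nbhd G v \<subseteq> ?V - {v}" for v
    using in_arcsD2 no_loops' by (auto simp: open_nbhd_def)
  have A: "card (A v) \<le> q ^ (card ?V - 1)" if "v \<in> ?V" for v
  proof -
    have "restrict c (open_nbhd G v) = restrict d (open_nbhd G v)"
      if "\<forall>u \<in> ?V - {v}. c u = d u" for c d :: "'a \<Rightarrow> nat"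
      using that N[of v] by (intro restrict_ext) auto
    then show ?thesis unfolding A_def
      by (intro card_determined_colorings[OF fin(1) \<open>v \<in> ?V\<close>]) metis
  qed
  have B: "card (B e) \<le> q ^ (card ?V - 1)" if "e \<in> ?E" for e
  proof -
    have "fst e \<in> ?V" "snd e \<in> ?V - {fst e}"
      using that arc_fst_in_verts[of e] arc_snd_in_verts[of e] pair_no_loops[of e] by auto
    then show ?thesis unfolding B_def by (intro card_determined_colorings[OF fin(1)]) auto
  qed
  have cov: "?C \<subseteq> (\<Union>v \<in> ?V. A v) \<union> (\<Union>e \<in> ?E. B e)"
  proof
    fix c assume c: "c \<in> ?C"
    show "c \<in> (\<Union>v \<in> ?V. A v) \<union> (\<Union>e \<in> ?E. B e)"
    proof (cases "c \<in> proper_colorings G q")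
      case True
      then obtain v where "v \<in> ?V" "g v (restrict c (open_nbhd G v)) = c v" using g by blast
      then have "c \<in> A v" using c by (simp add: A_def)
      then show ?thesis using \<open>v \<in> ?V\<close> by blast
    next
      case False
      then obtain e where "e \<in> ?E" "c (fst e) = c (snd e)"
        using c by (auto simp: proper_colorings_def)
      then have "c \<in> B e" using c by (simp add: B_def)
      then show ?thesis using \<open>e \<in> ?E\<close> by blast
    qed
  qed
  have finC: "finite ?C" using fin by (intro finite_PiE) auto
  have sub: "(\<Union>v \<in> ?V. A v) \<union> (\<Union>e \<in> ?E. B e) \<subseteq> ?C" unfolding A_def B_def by blast
  have "q ^ card ?V = card ?C" using fin by (simp add: card_PiE)
  also have "\<dots> \<le> card ((\<Union>v \<in> ?V. A v) \<union> (\<Union>e \<in> ?E. B e))"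
    by (rule card_mono[OF finite_subset[OF sub finC] cov])
  also have "\<dots> \<le> card (\<Union>v \<in> ?V. A v) + card (\<Union>e \<in> ?E. B e)" by (rule card_Un_le)
  also have "\<dots> \<le> (\<Sum>v \<in> ?V. card (A v)) + (\<Sum>e \<in> ?E. card (B e))"
    using fin by (intro add_mono card_UN_le)
  also have "\<dots> \<le> (\<Sum>v \<in> ?V. q ^ (card ?V - 1)) + (\<Sum>e \<in> ?E. q ^ (card ?V - 1))"
    using A B by (intro add_mono sum_mono)
  also have "\<dots> = (card ?V + card ?E) * q ^ (card ?V - 1)" by (simp add: algebra_simps)
  finally have "q ^ card ?V \<le> (card ?V + card ?E) * q ^ (card ?V - 1)" .
  moreover have "q ^ card ?V = q * q ^ (card ?V - 1)"
    using fin ne by (simp add: card_gt_0_iff power_eq_if)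
  ultimately show ?thesis using False by simp
qed simp

lemma HGP_greatest:
  assumes "pair_graph G" "pverts G \<noteq> {}"
  shows "winnable G (HGP G)" and "winnable G q \<Longrightarrow> q \<le> HGP G"
proof -
  have le: "\<forall>q. winnable G q \<longrightarrow> q \<le> card (pverts G) + card (parcs G)"
    using winnable_le[OF assms] by blast
  show "winnable G (HGP G)"
    unfolding HGP_def by (rule GreatestI_nat[where P = "winnable G", OF winnable_1[OF assms]]) (use le in blast)
  show "q \<le> HGP G" if "winnable G q"
    unfolding HGP_def by (rule Greatest_le_nat[where P = "winnable G", OF that]) (use le in blast)
qed

end

theory Submission
  imports Defs
begin

text \<open>
  Fix the colors z of the pages. The spines must save the pairs (x, y) of spine colors on which
  every page guesses wrong; the first spine sees y and guesses A y, the second sees x and guesses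
  B x, so this is possible iff the bipartite graph of these pairs can be oriented with one edge
  owned by each vertex.

  Upper bound: an orientable graph has at most as many edges as vertices. Give color c to one page
  and d to all the others, and sum over all (c, d), including c = d. The vertices contribute
  2 q (q - 1)^2, while each of the q (q - 1) pairs (x, y) survives for at least (q - 3) * 3 of the
  (c, d) when n + 4 \<le> q. Hence 3 (q - 3) \<le> 2 (q - 1), that is q \<le> 7.

  Lower bound: over a field with q elements let page m guess x + m (y - x). For q = 7 with three
  slopes m, and for q = 8 with all six m other than 0 and 1, the graph is orientable for every z,
  which is a finite check.
\<close>

section \<open>Bipartite graphs with one owned edge per vertex\<close>

definition orientable :: "('a \<times> 'b) set \<Rightarrow> bool" where
  "orientable E \<longleftrightarrow> (\<exists>A B. \<forall>x y. (x, y) \<in> E \<longrightarrow> x = A y \<or> y = B x)"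

text \<open>Page colors equal to \<open>x\<close> or \<open>y\<close> are excluded because only
  proper colorings have to be saved.\<close>

definition unguessed ::
  "nat \<Rightarrow> nat \<Rightarrow> (nat \<Rightarrow> nat \<Rightarrow> nat \<Rightarrow> nat) \<Rightarrow> (nat \<Rightarrow> nat) \<Rightarrow> (nat \<times> nat) set" where
  "unguessed q n f z =
     {(x, y). x < q \<and> y < q \<and> x \<noteq> y \<and> (\<forall>i<n. z i \<noteq> x \<and> z i \<noteq> y \<and> z i \<noteq> f i x y)}"

lemma orientableI: "(\<And>x y. (x, y) \<in> E \<Longrightarrow> x = A y \<or> y = B x) \<Longrightarrow> orientable E"
  unfolding orientable_def by auto

lemma orientable_subset: "orientable F \<Longrightarrow> E \<subseteq> F \<Longrightarrow> orientable E"
  unfolding orientable_def by blast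

text \<open>The graphs of \<open>B\<close> over \<open>X\<close> and of \<open>A\<close> over
  \<open>Y\<close> together cover \<open>E\<close>.\<close>

lemma card_orientable:
  assumes "orientable E" "E \<subseteq> X \<times> Y" "finite X" "finite Y"
  shows "card E \<le> card X + card Y"
proof -
  obtain A B where AB: "\<And>x y. (x, y) \<in> E \<Longrightarrow> x = A y \<or> y = B x"
    using assms(1) unfolding orientable_def by blast
  have "E \<subseteq> (\<lambda>x. (x, B x)) ` X \<union> (\<lambda>y. (A y, y)) ` Y"
    using AB assms(2) by fast
  then have "card E \<le> card ((\<lambda>x. (x, B x)) ` X \<union> (\<lambda>y. (A y, y)) ` Y)"
    using assms(3,4) by (intro card_mono) auto
  also have "\<dots> \<le> card ((\<lambda>x. (x, B x)) ` X) + card ((\<lambda>y. (A y, y)) ` Y)"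
    by (rule card_Un_le)
  also have "\<dots> \<le> card X + card Y"
    using assms(3,4) by (intro add_mono card_image_le)
  finally show ?thesis .
qed

section \<open>The game on a book as an orientation problem\<close>

lemma pverts_book_graph [simp]: "pverts (book_graph 2 n) = {Inl 0, Inl 1} \<union> Inr ` {..<n}"
  by (auto simp: book_graph_def graph_join_def complete_graph_def edgeless_graph_def)

lemma parcs_book_graph:
  "parcs (book_graph 2 n) = {(Inl 0, Inl 1), (Inl 1, Inl 0)} \<union>
     (\<Union>i<n. {(Inl 0, Inr i), (Inl 1, Inr i), (Inr i, Inl 0), (Inr i, Inl 1)})"
  by (auto simp: book_graph_def graph_join_def complete_graph_def edgeless_graph_def less_2_cases_iff)

lemma open_nbhd_book_graph:
  "open_nbhd (book_graph 2 n) (Inl 0) = insert (Inl 1) (Inr ` {..<n})"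
  "open_nbhd (book_graph 2 n) (Inl (Suc 0)) = insert (Inl 0) (Inr ` {..<n})"
  "i < n \<Longrightarrow> open_nbhd (book_graph 2 n) (Inr i) = {Inl 0, Inl 1}"
  by (auto simp: open_nbhd_def parcs_book_graph)

lemma proper_colorings_book_graph:
  "c \<in> proper_colorings (book_graph 2 n) q \<longleftrightarrow>
     c \<in> {Inl 0, Inl 1} \<union> Inr ` {..<n} \<rightarrow>\<^sub>E {..<q} \<and> c (Inl 0) \<noteq> c (Inl 1) \<and>
     (\<forall>i<n. c (Inr i) \<noteq> c (Inl 0) \<and> c (Inr i) \<noteq> c (Inl 1))"
proof -
  have "(\<forall>(u, v) \<in> parcs (book_graph 2 n). c u \<noteq> c v) \<longleftrightarrow> c (Inl 0) \<noteq> c (Inl 1) \<and>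
      (\<forall>i<n. c (Inr i) \<noteq> c (Inl 0) \<and> c (Inr i) \<noteq> c (Inl 1))"
    unfolding parcs_book_graph by fastforce
  then show ?thesis
    unfolding proper_colorings_def by simp
qed

lemma winnable_book_graph:
  assumes "q > 0"
  shows "winnable (book_graph 2 n) q \<longleftrightarrow>
    (\<exists>f. \<forall>z \<in> {..<n} \<rightarrow>\<^sub>E {..<q}. orientable (unguessed q n f z))"
proof
  assume "winnable (book_graph 2 n) q"
  then obtain g where g: "\<And>c. c \<in> proper_colorings (book_graph 2 n) q \<Longrightarrow>
      \<exists>v \<in> pverts (book_graph 2 n). g v (restrict c (open_nbhd (book_graph 2 n) v)) = c v"
    by (auto simp: winnable_def winning_strategy_def)
  define col where "col x y z v = case_sum (\<lambda>j. if j = 0 then x else y) z v"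
    for x y :: nat and z :: "nat \<Rightarrow> nat" and v :: "nat + nat"
  \<comment> \<open>The page colors are dummies: restriction to the spines discards them.\<close>
  define f where "f i x y = g (Inr i) (restrict (col x y undefined) {Inl 0, Inl 1})" for i x y
  have "orientable (unguessed q n f z)" if z: "z \<in> {..<n} \<rightarrow>\<^sub>E {..<q}" for z
  proof -
    \<comment> \<open>The 0 fills the slot of the spine's own color, which the restriction hides;
      likewise in \<open>B\<close>.\<close>
    define A where "A y = g (Inl 0) (restrict (col 0 y z) (insert (Inl 1) (Inr ` {..<n})))" for y
    define B where "B x = g (Inl 1) (restrict (col x 0 z) (insert (Inl 0) (Inr ` {..<n})))" for x
    have "x = A y \<or> y = B x" if xy: "(x, y) \<in> unguessed q n f z" for x y
    proof -
      let ?V = "{Inl 0, Inl 1} \<union> Inr ` {..<n}"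
      let ?c = "restrict (col x y z) ?V"
      have "?c \<in> proper_colorings (book_graph 2 n) q"
        using xy z by (auto simp: proper_colorings_book_graph unguessed_def col_def PiE_def Pi_def)
      from g[OF this] consider
          "g (Inl 0) (restrict ?c (insert (Inl 1) (Inr ` {..<n}))) = x"
        | "g (Inl 1) (restrict ?c (insert (Inl 0) (Inr ` {..<n}))) = y"
        | i where "i < n" "g (Inr i) (restrict ?c {Inl 0, Inl 1}) = z i"
        by (auto simp: open_nbhd_book_graph col_def)
      then show ?thesis
      proof cases
        case 1
        have "restrict ?c (insert (Inl 1) (Inr ` {..<n})) =
            restrict (col 0 y z) (insert (Inl 1) (Inr ` {..<n}))"
          by (rule ext) (auto simp: col_def restrict_def)
        then show ?thesis using 1 by (simp add: A_def)
      next
        case 2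
        have "restrict ?c (insert (Inl 0) (Inr ` {..<n})) =
            restrict (col x 0 z) (insert (Inl 0) (Inr ` {..<n}))"
          by (rule ext) (auto simp: col_def restrict_def)
        then show ?thesis using 2 by (simp add: B_def)
      next
        case 3
        have "restrict ?c {Inl 0, Inl 1} = restrict (col x y undefined) {Inl 0, Inl 1}"
          by (rule ext) (auto simp: col_def restrict_def)
        then have "f i x y = z i" using 3 by (simp add: f_def)
        then show ?thesis using xy 3(1) by (auto simp: unguessed_def)
      qed
    qed
    then show ?thesis by (rule orientableI)
  qed
  then show "\<exists>f. \<forall>z \<in> {..<n} \<rightarrow>\<^sub>E {..<q}. orientable (unguessed q n f z)" by blast
next
  assume "\<exists>f. \<forall>z \<in> {..<n} \<rightarrow>\<^sub>E {..<q}. orientable (unguessed q n f z)"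
  then obtain f where "\<forall>z \<in> {..<n} \<rightarrow>\<^sub>E {..<q}. \<exists>A B. \<forall>x y.
      (x, y) \<in> unguessed q n f z \<longrightarrow> x = A y \<or> y = B x"
    unfolding orientable_def by blast
  then obtain A B where AB: "\<And>z x y. z \<in> {..<n} \<rightarrow>\<^sub>E {..<q} \<Longrightarrow> (x, y) \<in> unguessed q n f z \<Longrightarrow>
      x = A z y \<or> y = B z x"
    by metis
  define raw where "raw v d = (case v of
      Inl j \<Rightarrow> if j = 0 then A (\<lambda>i. d (Inr i)) (d (Inl 1)) else B (\<lambda>i. d (Inr i)) (d (Inl 0))
    | Inr i \<Rightarrow> f i (d (Inl 0)) (d (Inl 1)))" for v :: "nat + nat" and d :: "nat + nat \<Rightarrow> nat"
  \<comment> \<open>Clipping makes every guess legal and loses nothing: a raw guess that equals an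
    actual color is already below \<open>q\<close>.\<close>
  define g where "g v d = (if raw v d < q then raw v d else 0)" for v d
  have "\<exists>v \<in> pverts (book_graph 2 n). g v (restrict c (open_nbhd (book_graph 2 n) v)) = c v"
    if c: "c \<in> proper_colorings (book_graph 2 n) q" for c
  proof -
    let ?x = "c (Inl 0)" and ?y = "c (Inl 1)"
    let ?z = "restrict (\<lambda>i. c (Inr i)) {..<n}"
    have lt: "c v < q" if "v \<in> pverts (book_graph 2 n)" for v
      using c that unfolding proper_colorings_book_graph by auto
    have win: ?thesis if "v \<in> pverts (book_graph 2 n)"
      "raw v (restrict c (open_nbhd (book_graph 2 n) v)) = c v" for v
      using that lt by (metis g_def)
    have z: "?z \<in> {..<n} \<rightarrow>\<^sub>E {..<q}" using lt by auto
    show ?thesis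
    proof (cases "(?x, ?y) \<in> unguessed q n f ?z")
      case True
      have "(\<lambda>i. if (Inr i :: nat + nat) \<in> Inr ` {..<n} then c (Inr i) else undefined) = ?z"
        by (auto simp: restrict_def)
      then have "raw (Inl 0) (restrict c (open_nbhd (book_graph 2 n) (Inl 0))) = A ?z ?y"
        "raw (Inl 1) (restrict c (open_nbhd (book_graph 2 n) (Inl 1))) = B ?z ?x"
        by (auto simp: raw_def open_nbhd_book_graph)
      then show ?thesis using AB[OF z True] win[of "Inl 0"] win[of "Inl 1"] by auto
    next
      case False
      then obtain i where i: "i < n" "f i ?x ?y = c (Inr i)"
        using c lt[of "Inl 0"] lt[of "Inl 1"]
        unfolding unguessed_def proper_colorings_book_graph by auto
      then have "raw (Inr i) (restrict c (open_nbhd (book_graph 2 n) (Inr i))) = c (Inr i)"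
        by (simp add: raw_def open_nbhd_book_graph)
      then show ?thesis using i(1) by (intro win[of "Inr i"]) auto
    qed
  qed
  moreover have "g \<in> strategies (book_graph 2 n) q"
    using assms by (auto simp: strategies_def g_def)
  ultimately show "winnable (book_graph 2 n) q"
    unfolding winnable_def winning_strategy_def by blast
qed

text \<open>Further pages can only shrink the set of pairs left to the spines.\<close>

lemma winnable_book_graph_mono:
  assumes "winnable (book_graph 2 m) q" "m \<le> n" "q > 0"
  shows "winnable (book_graph 2 n) q"
proof -
  obtain f where f: "\<forall>z \<in> {..<m} \<rightarrow>\<^sub>E {..<q}. orientable (unguessed q m f z)"
    using assms winnable_book_graph by blast
  have "orientable (unguessed q n f z)" if "z \<in> {..<n} \<rightarrow>\<^sub>E {..<q}" for z
  proof (rule orientable_subset)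
    show "orientable (unguessed q m f (restrict z {..<m}))"
      using f that assms(2) by (auto simp: PiE_def Pi_def)
    show "unguessed q n f z \<subseteq> unguessed q m f (restrict z {..<m})"
      using less_le_trans[OF _ assms(2)] by (fastforce simp: unguessed_def)
  qed
  then show ?thesis using winnable_book_graph[OF assms(3)] by blast
qed

section \<open>Upper bound by double counting\<close>

lemma not_winnable_book_graph:
  assumes "8 \<le> q" "2 \<le> n" "n + 4 \<le> q"
  shows "\<not> winnable (book_graph 2 n) q"
proof
  assume "winnable (book_graph 2 n) q"
  then obtain f where f: "\<forall>z \<in> {..<n} \<rightarrow>\<^sub>E {..<q}. orientable (unguessed q n f z)"
    using winnable_book_graph assms(1) by auto
  define E where "E w = unguessed q n f (\<lambda>i\<in>{..<n}. if i = 0 then fst w else snd w)" for w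
  define P where "P = {(x, y). x < q \<and> y < q \<and> x \<noteq> y}"
  let ?Q = "{..<q} \<times> {..<q}"
  have P: "P = ?Q - (\<lambda>x. (x, x)) ` {..<q}" unfolding P_def by auto
  have finP: "finite P" unfolding P by simp
  have cardP: "card P = q * (q - 1)"
    unfolding P by (subst card_Diff_subset) (auto simp: card_image inj_on_def algebra_simps)
  have EP: "E w \<subseteq> P" for w by (auto simp: E_def unguessed_def P_def)
  have upper: "card (E (c, d)) \<le> 2 * card ({..<q} - {c, d})" if "c < q" "d < q" for c d
  proof -
    have "orientable (E (c, d))" unfolding E_def using f that by auto
    moreover have "E (c, d) \<subseteq> ({..<q} - {c, d}) \<times> ({..<q} - {c, d})"
    proof (rule subrelI)
      fix x y assume "(x, y) \<in> E (c, d)"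
      then have "x < q" "y < q"
        and *: "\<And>i. i < n \<Longrightarrow> (if i = 0 then c else d) \<noteq> x \<and> (if i = 0 then c else d) \<noteq> y"
        by (auto simp: E_def unguessed_def)
      \<comment> \<open>With at least two pages both \<open>c\<close> and \<open>d\<close> occur, so
        each spine avoids both.\<close>
      then show "(x, y) \<in> ({..<q} - {c, d}) \<times> ({..<q} - {c, d})"
        using *[of 0] *[of 1] assms(2) by auto
    qed
    ultimately show ?thesis using card_orientable[of "E (c, d)"] by (simp add: mult_2)
  qed
  have lower: "3 * (q - 3) \<le> card {w \<in> ?Q. (x, y) \<in> E w}" if xy: "(x, y) \<in> P" for x y
  proof -
    \<comment> \<open>\<open>c\<close> must avoid \<open>x\<close>, \<open>y\<close> and one guess;
      \<open>d\<close> must avoid \<open>x\<close>, \<open>y\<close> and at most n - 1 guesses,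
      which leaves at least q - 2 - (n - 1) \<ge> 3 colors.\<close>
    let ?G = "(\<lambda>i. f i x y) ` {1..<n}"
    let ?C = "{..<q} - {x, y, f 0 x y}" and ?D = "{..<q} - ({x, y} \<union> ?G)"
    have "card {x, y, f 0 x y} \<le> 3" by (simp add: card_insert_if)
    then have C: "q - 3 \<le> card ?C"
      using diff_card_le_card_Diff[of "{x, y, f 0 x y}" "{..<q}"] by simp
    have "card ({x, y} \<union> ?G) \<le> card {x, y} + card ?G" by (rule card_Un_le)
    also have "\<dots> \<le> 2 + (n - 1)"
      using card_image_le[of "{1..<n}" "\<lambda>i. f i x y"] by (intro add_mono) (auto simp: card_insert_if)
    finally have D: "3 \<le> card ?D"
      using diff_card_le_card_Diff[of "{x, y} \<union> ?G" "{..<q}"] assms by simp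
    have "?C \<times> ?D \<subseteq> {w \<in> ?Q. (x, y) \<in> E w}"
      using xy by (auto simp: E_def unguessed_def P_def)
    then have "card (?C \<times> ?D) \<le> card {w \<in> ?Q. (x, y) \<in> E w}"
      by (intro card_mono) (auto intro: finite_subset[of _ ?Q])
    then show ?thesis using mult_le_mono[OF D C] by (simp add: card_cartesian_product mult.commute)
  qed
  have "3 * (q - 3) * (q * (q - 1)) = (\<Sum>p \<in> P. 3 * (q - 3))" by (simp add: cardP)
  also have "\<dots> \<le> (\<Sum>p \<in> P. card {w \<in> ?Q. p \<in> E w})"
    using lower by (intro sum_mono) auto
  also have "\<dots> = (\<Sum>w \<in> ?Q. card {p \<in> P. p \<in> E w})"
    using finP by (intro sum_multicount_gen[symmetric]) auto
  also have "\<dots> = (\<Sum>w \<in> ?Q. card (E w))"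
    using EP by (intro sum.cong refl arg_cong[where f = card]) auto
  also have "\<dots> \<le> (\<Sum>w \<in> ?Q. 2 * card ({..<q} - {fst w, snd w}))"
    using upper by (intro sum_mono) auto
  also have "\<dots> = (\<Sum>c<q. \<Sum>d<q. 2 * card ({..<q} - {c, d}))"
    by (simp add: sum.cartesian_product case_prod_unfold)
  also have "\<dots> = (\<Sum>c<q. 2 * (q - 1) * (q - 1))"
  proof (rule sum.cong[OF refl])
    fix c assume c: "c \<in> {..<q}"
    \<comment> \<open>The term d = c is split off, since there only one color is forbidden to the
      spines.\<close>
    have "(\<Sum>d<q. 2 * card ({..<q} - {c, d})) =
        2 * card ({..<q} - {c, c}) + (\<Sum>d \<in> {..<q} - {c}. 2 * card ({..<q} - {c, d}))"
      using c by (subst sum.remove[of _ c]) auto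
    also have "(\<Sum>d \<in> {..<q} - {c}. 2 * card ({..<q} - {c, d})) = (\<Sum>d \<in> {..<q} - {c}. 2 * (q - 2))"
      using c by (intro sum.cong refl) (auto simp: card_Diff_subset)
    also have "2 * card ({..<q} - {c, c}) + \<dots> = 2 * (q - 1) + (q - 1) * (2 * (q - 2))"
      using c by simp
    also have "\<dots> = 2 * (q - 1) * (q - 1)"
    proof -
      obtain r where "q = r + 2" using assms(1) le_Suc_ex[of 2 q] by auto
      then show ?thesis by (simp add: algebra_simps)
    qed
    finally show "(\<Sum>d<q. 2 * card ({..<q} - {c, d})) = 2 * (q - 1) * (q - 1)" .
  qed
  finally have "q * (q - 1) * (3 * (q - 3)) \<le> q * (q - 1) * (2 * (q - 1))"
    by (simp add: mult_ac)
  moreover have "0 < q * (q - 1)" using assms(1) by simp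
  ultimately have "3 * (q - 3) \<le> 2 * (q - 1)" by (simp only: mult_le_cancel1)
  then show False using assms(1) by linarith
qed

section \<open>Searching all page colorings\<close>

text \<open>
  A strategy is stored as one row per color x of the first spine; the row lists the colors y of
  the second spine together with the guesses of the pages on (x, y).
\<close>

type_synonym 'a table = "('a \<times> ('a \<times> 'a list) list) list"

definition table :: "nat \<Rightarrow> nat \<Rightarrow> (nat \<Rightarrow> nat \<Rightarrow> nat \<Rightarrow> nat) \<Rightarrow> nat table" where
  "table q n f =
     map (\<lambda>x. (x, map (\<lambda>y. (y, map (\<lambda>i. f i x y) [0..<n])) (filter (\<lambda>y. y \<noteq> x) [0..<q]))) [0..<q]"

text \<open>\<open>z\<close> colors only the pages whose guesses are still in the table, so that it
  can shrink along with the guess lists.\<close>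

definition surviving :: "'a list \<Rightarrow> 'a table \<Rightarrow> ('a \<times> 'a) set" where
  "surviving z rows = {(x, y). \<exists>ps gs. (x, ps) \<in> set rows \<and> (y, gs) \<in> set ps \<and>
     x \<notin> set z \<and> y \<notin> set z \<and> list_all2 (\<noteq>) gs z}"

fun drop_at_most_one :: "'a list \<Rightarrow> 'a list list" where
  "drop_at_most_one [] = [[]]"
| "drop_at_most_one (y # ys) = ys # map ((#) y) (drop_at_most_one ys)"

text \<open>
  In every row x one entry is left to the guess B x and the other entries y require A y = x,
  so they may not be required by another row; U collects the y used so far.
\<close>

fun absorb :: "'a table \<Rightarrow> 'a list \<Rightarrow> bool" where
  "absorb [] U = True"
| "absorb ((x, ps) # rows) U =
     list_ex (\<lambda>ys. list_all (\<lambda>y. y \<notin> set U) ys \<and> absorb rows (ys @ U))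
       (drop_at_most_one (map fst ps))"

text \<open>One search step: the first remaining page receives color \<open>c\<close>, and its
  guesses leave the table.\<close>

definition fix_page :: "'a \<Rightarrow> 'a table \<Rightarrow> 'a table" where
  "fix_page c rows =
     map (map_prod id (\<lambda>ps. map (map_prod id tl) (filter (\<lambda>(y, gs). y \<noteq> c \<and> hd gs \<noteq> c) ps)))
       (filter (\<lambda>(x, ps). x \<noteq> c) rows)"

text \<open>
  The recursion over the colors is spelled out instead of using \<open>list_all\<close>: symbolic evaluation
  would otherwise unfold the search under the binder of the color.
\<close>

fun absorbs_all :: "'a list \<Rightarrow> nat \<Rightarrow> 'a table \<Rightarrow> bool"
and absorbs_each :: "'a list \<Rightarrow> 'a list \<Rightarrow> nat \<Rightarrow> 'a table \<Rightarrow> bool" where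
  "absorbs_all C 0 rows = absorb rows []"
| "absorbs_all C (Suc k) rows = (absorb rows [] \<or> absorbs_each C C k rows)"
| "absorbs_each C [] k rows = True"
| "absorbs_each C (c # cs) k rows =
     (absorbs_all C k (fix_page c rows) \<and> absorbs_each C cs k rows)"

lemma drop_at_most_one_subset:
  "ys \<in> set (drop_at_most_one zs) \<Longrightarrow> \<exists>w. set zs \<subseteq> insert w (set ys)"
  by (induction zs arbitrary: ys) fastforce+

text \<open>Carrying \<open>y \<notin> set U\<close> through the induction keeps the values of
  \<open>A\<close> claimed by earlier rows untouched by later ones. Distinct row labels do the same
  for \<open>B\<close>.\<close>

lemma absorb_sound:
  assumes "absorb rows U" "distinct (map fst rows)"
  shows "\<exists>A B. \<forall>x ps y. (x, ps) \<in> set rows \<longrightarrow> y \<in> fst ` set ps \<longrightarrow>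
    (x = A y \<and> y \<notin> set U) \<or> y = B x"
  using assms
proof (induction rows arbitrary: U)
  case (Cons row rows)
  obtain x ps where row: "row = (x, ps)" by (cases row)
  obtain ys where ys: "ys \<in> set (drop_at_most_one (map fst ps))" "\<forall>y \<in> set ys. y \<notin> set U"
    "absorb rows (ys @ U)"
    using Cons.prems(1) by (auto simp: row list_ex_iff list_all_iff)
  obtain w where w: "fst ` set ps \<subseteq> insert w (set ys)"
    using drop_at_most_one_subset[OF ys(1)] by auto
  have "distinct (map fst rows)" using Cons.prems(2) by simp
  from Cons.IH[OF ys(3) this] obtain A B
    where AB: "\<And>x' ps' y. (x', ps') \<in> set rows \<Longrightarrow> y \<in> fst ` set ps' \<Longrightarrow>
      (x' = A y \<and> y \<notin> set (ys @ U)) \<or> y = B x'"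
    by blast
  \<comment> \<open>Overriding \<open>A\<close> on \<open>ys\<close> is safe: the later rows rely on
    \<open>A\<close> only outside \<open>ys @ U\<close>.\<close>
  define A' where "A' y = (if y \<in> set ys then x else A y)" for y
  have *: "(x' = A' y \<and> y \<notin> set U) \<or> y = (B(x := w)) x'"
    if "(x', ps') \<in> set (row # rows)" "y \<in> fst ` set ps'" for x' ps' y
  proof (cases "(x', ps') \<in> set rows")
    case True
    then have "x' \<noteq> x" using Cons.prems(2) by (force simp: row)
    then show ?thesis using AB[OF True that(2)] by (auto simp: A'_def)
  next
    case False
    then have "x' = x" "ps' = ps" using that(1) by (auto simp: row)
    then show ?thesis using w ys(2) that(2) by (auto simp: A'_def)
  qed
  show ?case by (intro exI[of _ A'] exI[of _ "B(x := w)"] allI impI) (rule *)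
qed simp

lemma absorb_imp_orientable:
  assumes "absorb rows []" "distinct (map fst rows)"
  shows "orientable (surviving z rows)"
proof -
  obtain A B where "\<And>x ps y. (x, ps) \<in> set rows \<Longrightarrow> y \<in> fst ` set ps \<Longrightarrow> x = A y \<or> y = B x"
    using absorb_sound[OF assms] by metis
  then show ?thesis
    by (intro orientableI[of _ A B]) (force simp: surviving_def)
qed

lemma absorbs_each_iff: "absorbs_each C cs k rows \<longleftrightarrow> (\<forall>c \<in> set cs. absorbs_all C k (fix_page c rows))"
  by (induction cs) auto

lemma surviving_fix_page: "surviving (c # z) rows \<subseteq> surviving z (fix_page c rows)"
  unfolding surviving_def fix_page_def
  by (fastforce simp: list_all2_Cons2 image_iff)

lemma distinct_fix_page: "distinct (map fst rows) \<Longrightarrow> distinct (map fst (fix_page c rows))"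
  unfolding fix_page_def by (simp add: distinct_map_filter)

lemma absorbs_all_imp_orientable:
  assumes "absorbs_all C (length z) rows" "set z \<subseteq> set C" "distinct (map fst rows)"
  shows "orientable (surviving z rows)"
  using assms
proof (induction z arbitrary: rows)
  case Nil
  then show ?case by (simp add: absorb_imp_orientable)
next
  case (Cons c z)
  \<comment> \<open>The first case is the pruning of the search: coloring more pages only deletes
    pairs from an orientable graph.\<close>
  consider "absorb rows []" | "absorbs_all C (length z) (fix_page c rows)"
    using Cons.prems(1,2) by (auto simp: absorbs_each_iff)
  then show ?case
  proof cases
    case 1
    then show ?thesis using Cons.prems(3) by (rule absorb_imp_orientable)
  next
    case 2
    then have "orientable (surviving z (fix_page c rows))"
      using Cons.IH[OF 2] Cons.prems(2) distinct_fix_page[OF Cons.prems(3)] by simp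
    then show ?thesis using surviving_fix_page by (rule orientable_subset)
  qed
qed

lemma unguessed_subset_surviving: "unguessed q n f z \<subseteq> surviving (map z [0..<n]) (table q n f)"
  by (fastforce simp: unguessed_def surviving_def table_def list_all2_conv_all_nth image_iff)

lemma distinct_table: "distinct (map fst (table q n f))"
  by (simp add: table_def comp_def)

lemma absorbs_all_imp_orientable_unguessed:
  assumes "absorbs_all [0..<q] n (table q n f)" "\<And>i. i < n \<Longrightarrow> z i < q"
  shows "orientable (unguessed q n f z)"
proof -
  have "orientable (surviving (map z [0..<n]) (table q n f))"
    using assms distinct_table by (intro absorbs_all_imp_orientable[where C = "[0..<q]"]) auto
  then show ?thesis using unguessed_subset_surviving by (rule orientable_subset)
qed

section \<open>Affine strategies\<close>

lemma winnable_book_graph_3_7: "winnable (book_graph 2 3) 7"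
proof -
  \<comment> \<open>The slopes are 2, 3 and 4; adding 7 keeps the natural subtraction from
    truncating.\<close>
  define f :: "nat \<Rightarrow> nat \<Rightarrow> nat \<Rightarrow> nat" where "f = (\<lambda>i x y. (x + (i + 2) * (y + 7 - x)) mod 7)"
  have "absorbs_all [0..<7] 3 (table 7 3 f)"
    unfolding f_def by code_simp
  then have "orientable (unguessed 7 3 f z)" if "z \<in> {..<3} \<rightarrow>\<^sub>E {..<7}" for z
    using that by (intro absorbs_all_imp_orientable_unguessed) (auto simp only: PiE_mem lessThan_iff)
  then show ?thesis by (subst winnable_book_graph) auto
qed

text \<open>
  The elements of the field with eight elements are coded by the coefficient bits of polynomials
  modulo t^3 + t + 1, so addition is \<^const>\<open>xor\<close>; row i of the table is multiplication by i + 2.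
\<close>

definition mult_F8 :: "nat list list" where
  "mult_F8 =
    [[0, 2, 4, 6, 3, 1, 7, 5],
     [0, 3, 6, 5, 7, 4, 1, 2],
     [0, 4, 3, 7, 6, 2, 5, 1],
     [0, 5, 1, 4, 2, 7, 3, 6],
     [0, 6, 7, 1, 5, 3, 2, 4],
     [0, 7, 5, 2, 1, 6, 4, 3]]"

text \<open>This is x + m (y - x) with slope m = i + 2; in characteristic 2 the difference is
  \<open>xor\<close> too.\<close>

definition guess_F8 :: "nat \<Rightarrow> nat \<Rightarrow> nat \<Rightarrow> nat" where
  "guess_F8 i x y = xor x (mult_F8 ! i ! xor x y)"

lemma xor_less_8: "xor x y < 8" if "x < 8" "y < 8" for x y :: nat
proof -
  have "take_bit 3 (xor x y) = xor x y" using that by (simp add: take_bit_nat_eq_self)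
  then have "xor x y < 2 ^ 3" by (metis take_bit_nat_less_exp)
  then show ?thesis by simp
qed

lemma xor_xor_cancel [simp]: "xor a (xor a b) = b" for a b :: nat
  by (simp flip: xor.assoc)

text \<open>Translation preserves the difference \<open>xor x y\<close>, so only the summand
  \<open>x\<close> moves.\<close>

lemma guess_F8_translate: "guess_F8 i (xor t x) (xor t y) = xor t (guess_F8 i x y)"
proof -
  have "xor (xor t x) (xor t y) = xor x y" by (metis xor.assoc xor.commute xor_xor_cancel)
  then show ?thesis by (simp add: guess_F8_def xor.assoc)
qed

text \<open>By translation invariance the color of page 0 may be taken to be 0.\<close>

lemma orientable_unguessed_F8:
  assumes "\<And>i. i < 6 \<Longrightarrow> z i < 8"
  shows "orientable (unguessed 8 6 guess_F8 z)"
proof -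
  define z' where "z' i = xor (z 0) (z i)" for i
  have z': "z' 0 = 0" "\<And>i. i < 6 \<Longrightarrow> z' i < 8" using assms by (auto simp: z'_def xor_less_8)
  \<comment> \<open>Page 0 is fixed to color 0, which leaves five pages to search.\<close>
  have "absorbs_all [0..<8] 5 (fix_page 0 (table 8 6 guess_F8))"
    by code_simp
  moreover have "length (map z' [1..<6]) = 5" by simp
  ultimately have "absorbs_all [0..<8] (length (map z' [1..<6])) (fix_page 0 (table 8 6 guess_F8))"
    by (simp only:)
  moreover have "set (map z' [1..<6]) \<subseteq> set [0..<8]" using z'(2) by auto
  ultimately have "orientable (surviving (map z' [1..<6]) (fix_page 0 (table 8 6 guess_F8)))"
    by (rule absorbs_all_imp_orientable[OF _ _ distinct_fix_page[OF distinct_table]])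
  then have "orientable (surviving (0 # map z' [1..<6]) (table 8 6 guess_F8))"
    using surviving_fix_page by (rule orientable_subset)
  moreover have "0 # map z' [1..<6] = map z' [0..<6]" using z'(1) by (simp add: upt_rec)
  ultimately have "orientable (surviving (map z' [0..<6]) (table 8 6 guess_F8))" by simp
  then have "orientable (unguessed 8 6 guess_F8 z')"
    using unguessed_subset_surviving by (rule orientable_subset)
  then obtain A B where
    AB: "\<And>x y. (x, y) \<in> unguessed 8 6 guess_F8 z' \<Longrightarrow> x = A y \<or> y = B x"
    unfolding orientable_def by blast
  let ?t = "xor (z 0)"
  \<comment> \<open>Translation by \<open>z 0\<close> is an involution, so conjugating
    \<open>A\<close> and \<open>B\<close> by it carries the orientation back to
    \<open>z\<close>.\<close>
  have "x = ?t (A (?t y)) \<or> y = ?t (B (?t x))" if xy: "(x, y) \<in> unguessed 8 6 guess_F8 z" for x y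
  proof -
    have inj: "?t a = ?t b \<longleftrightarrow> a = b" for a b by (metis xor_xor_cancel)
    have "(?t x, ?t y) \<in> unguessed 8 6 guess_F8 z'"
      using xy assms[of 0] by (auto simp: unguessed_def z'_def guess_F8_translate inj xor_less_8)
    from AB[OF this] show ?thesis by (metis xor_xor_cancel)
  qed
  then show ?thesis by (rule orientableI)
qed

lemma winnable_book_graph_6_8: "winnable (book_graph 2 6) 8"
  by (subst winnable_book_graph) (auto intro!: exI[of _ guess_F8] orientable_unguessed_F8)

theorem theorem1p3:
  shows "HGP (book_graph 2 3) = 7 \<and> HGP (book_graph 2 4) = 7 \<and>
    (\<forall>n \<ge> 4. HGP (book_graph 2 n) \<le> n + 3) \<and>
    (\<forall>n \<ge> 6. 8 \<le> HGP (book_graph 2 n))"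
proof -
  have win: "winnable (book_graph 2 n) (HGP (book_graph 2 n))"
    and greatest: "winnable (book_graph 2 n) q \<Longrightarrow> q \<le> HGP (book_graph 2 n)" for n q
    using HGP_greatest[OF pair_graph_book_graph, of 2 n] by auto
  have upper: "HGP (book_graph 2 n) \<le> n + 3" if "4 \<le> n" for n
    using not_winnable_book_graph[of "HGP (book_graph 2 n)" n] win[of n] that by linarith
  \<comment> \<open>For n = 3 the binding hypothesis is \<open>8 \<le> q\<close> rather than
    \<open>n + 4 \<le> q\<close>, hence 7 instead of n + 3.\<close>
  have "HGP (book_graph 2 3) \<le> 7"
    using not_winnable_book_graph[of "HGP (book_graph 2 3)" 3] win[of 3] by linarith
  moreover have "7 \<le> HGP (book_graph 2 3)"
    by (rule greatest[OF winnable_book_graph_3_7])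
  moreover have "7 \<le> HGP (book_graph 2 4)"
    by (rule greatest, rule winnable_book_graph_mono[OF winnable_book_graph_3_7]) auto
  moreover have "8 \<le> HGP (book_graph 2 n)" if "6 \<le> n" for n
    using that by (intro greatest winnable_book_graph_mono[OF winnable_book_graph_6_8]) auto
  ultimately show ?thesis using upper[of 4] upper by fastforce
qed

end
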